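(* Let $K$ be an infinite field and $S=K[x_1,\ldots,x_n]$. For any squarefree monomial ideals $0\subseteq I\subsetneq J\subseteq S$, we have $$\operatorname{hdepth}(J/I)\geq\operatorname{depth}(J/I),$$ where $\operatorname{hdepth}$ denotes the Hilbert depth.
   Context: $S$ has the standard grading. For a finitely generated graded $S$-module $M$, $H_M(t)=\sum_{j}(\dim_K M_j)t^j$ is its Hilbert series. The Hilbert depth $\operatorname{hdepth}(M)$ is the maximal $r$ such that there exists a finitely generated graded $S$-module $N$ with $H_N(t)=H_M(t)$ and $\operatorname{depth}(N)=r$. By a theorem of Uliczka, $\operatorname{hdepth}(M)$ is equivalently the maximal $r$ such that all coefficients of the power series $(1-t)^rH_M(t)$ are nonnegative. For squarefree monomial ideals $I\subsetneq J\subseteq S$, put $\alpha_j(J/I)=|\{A\subseteq[n] : |A|=j,\ \prod_{i\in A}x_i\in J\setminus I\}|$ and $\beta_k^q(J/I)=\sum_{j=0}^k(-1)^{k-j}\binom{q-j}{k-j}\alpha_j(J/I)$. Then, equivalently (a previously known result), $\operatorname{hdepth}(J/I)=\max\{q : 0\le q\le n,\ \beta_k^q(J/I)\ge 0\text{ for all }0\le k\le q\}$. $\operatorname{depth}$ is the depth with respect to $(x_1,\ldots,x_n)$. *)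

theory Defs
  imports
    "HOL-Library.Poly_Mapping"
    "HOL-Algebra.QuotRing"
    "Jordan_Normal_Form.VS_Connect"
begin

section \<open>The polynomial ring\<close>

text \<open>The variables are indexed by a finite type \<open>'n\<close>, so the ring is
  $S = K[x_1, \dots, x_n]$ with $n$ the cardinality of \<open>'n\<close>. Exponent vectors are finitely
  supported functions and polynomials are finitely supported functions on exponent vectors;
  the product of \<^theory>\<open>HOL-Library.Poly_Mapping\<close> is the convolution product.\<close>

type_synonym ('n, 'k) mpoly = "('n \<Rightarrow>\<^sub>0 nat) \<Rightarrow>\<^sub>0 'k"

abbreviation poly_ring :: "('n::finite, 'k::field) mpoly ring" where
  "poly_ring \<equiv> class_ring"

definition Const :: "'k \<Rightarrow> ('n::finite, 'k::field) mpoly" where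
  "Const c = Poly_Mapping.single 0 c"

definition Var :: "'n \<Rightarrow> ('n::finite, 'k::field) mpoly" where
  "Var i = Poly_Mapping.single (Poly_Mapping.single i 1) 1"

definition mon_deg :: "('n::finite \<Rightarrow>\<^sub>0 nat) \<Rightarrow> nat" where
  "mon_deg m = (\<Sum>i\<in>UNIV. Poly_Mapping.lookup m i)"

definition homogeneous_polys :: "int \<Rightarrow> ('n::finite, 'k::field) mpoly set" where
  "homogeneous_polys j = {f. \<forall>m\<in>Poly_Mapping.keys f. int (mon_deg m) = j}"

definition max_ideal :: "('n::finite, 'k::field) mpoly set" where
  "max_ideal = Idl\<^bsub>poly_ring\<^esub> (range Var)"

definition squarefree_monomial_ideal :: "('n::finite, 'k::field) mpoly set \<Rightarrow> bool" where
  "squarefree_monomial_ideal I \<longleftrightarrow>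
     (\<exists>F :: 'n set set. I = Idl\<^bsub>poly_ring\<^esub> ((\<lambda>A. \<Prod>i\<in>A. Var i) ` F))"


section \<open>Depth\<close>

text \<open>The submodule $(f_1, \dots, f_r)M$ of $M$.\<close>

definition ideal_mult :: "('a, 'm) ring_scheme \<Rightarrow> ('a, 'b, 'c) module_scheme \<Rightarrow> 'a list \<Rightarrow> 'b set"
  where "ideal_mult R M fs =
    LinearCombinations.module.span R M {f \<odot>\<^bsub>M\<^esub> x | f x. f \<in> set fs \<and> x \<in> carrier M}"

text \<open>The first condition says that $f_{i+1}$ is a nonzerodivisor on
  $M / (f_1, \dots, f_i)M$, written out without forming the quotient; the second one says
  $M / (f_1, \dots, f_r)M \neq 0$.\<close>

definition regular_sequence ::
    "('a, 'm) ring_scheme \<Rightarrow> ('a, 'b, 'c) module_scheme \<Rightarrow> 'a list \<Rightarrow> bool"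
  where "regular_sequence R M fs \<longleftrightarrow>
    set fs \<subseteq> carrier R \<and>
    (\<forall>i<length fs. \<forall>x\<in>carrier M.
        (fs ! i) \<odot>\<^bsub>M\<^esub> x \<in> ideal_mult R M (take i fs) \<longrightarrow> x \<in> ideal_mult R M (take i fs)) \<and>
    ideal_mult R M fs \<noteq> carrier M"

text \<open>The elements of the sequence need not be homogeneous. For a nonzero finitely generated
  graded module over \<^term>\<open>poly_ring\<close> and \<^term>\<open>max_ideal\<close> the set below is finite and contains
  \<open>0\<close>, so the maximum exists. (The zero module has no regular sequence in this sense and its
  depth is unspecified.)\<close>

definition depth_wrt ::
    "('a, 'm) ring_scheme \<Rightarrow> 'a set \<Rightarrow> ('a, 'b, 'c) module_scheme \<Rightarrow> nat"
  where "depth_wrt R \<aa> M = Max {length fs | fs. set fs \<subseteq> \<aa> \<and> regular_sequence R M fs}"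

definition depth :: "(('n::finite, 'k::field) mpoly, 'b) module \<Rightarrow> nat" where
  "depth M = depth_wrt poly_ring max_ideal M"


section \<open>Graded modules and Hilbert series\<close>

definition fin_gen_module :: "('a, 'm) ring_scheme \<Rightarrow> ('a, 'b, 'c) module_scheme \<Rightarrow> bool" where
  "fin_gen_module R M \<longleftrightarrow> module R M \<and>
     (\<exists>A. finite A \<and> A \<subseteq> carrier M \<and> LinearCombinations.module.span R M A = carrier M)"

text \<open>A $\mathbb{Z}$-grading \<open>D\<close> of \<open>M\<close>: the last clause is the direct sum decomposition
  $M = \bigoplus_j D_j$.\<close>

definition graded_module ::
    "(('n::finite, 'k::field) mpoly, 'b) module \<Rightarrow> (int \<Rightarrow> 'b set) \<Rightarrow> bool"
  where "graded_module M D \<longleftrightarrow>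
    module poly_ring M \<and>
    (\<forall>j. additive_subgroup (D j) M) \<and>
    (\<forall>i j. \<forall>f\<in>homogeneous_polys i. \<forall>x\<in>D j. f \<odot>\<^bsub>M\<^esub> x \<in> D (i + j)) \<and>
    (\<forall>x\<in>carrier M. \<exists>!c. (\<forall>j. c j \<in> D j) \<and> finite {j. c j \<noteq> \<zero>\<^bsub>M\<^esub>} \<and>
        x = (\<Oplus>\<^bsub>M\<^esub>j\<in>{j. c j \<noteq> \<zero>\<^bsub>M\<^esub>}. c j))"

text \<open>A subset of an \<open>S\<close>-module, as a \<open>K\<close>-vector space. The record of modules has ring
  multiplication and unit as fields, which play no role for modules.\<close>

definition restrict_scalars ::
    "(('n::finite, 'k::field) mpoly, 'b) module \<Rightarrow> 'b set \<Rightarrow> ('k, 'b) module"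
  where "restrict_scalars M V =
    \<lparr>carrier = V, mult = mult M, one = one M, zero = zero M, add = add M,
     smult = (\<lambda>c x. Const c \<odot>\<^bsub>M\<^esub> x)\<rparr>"

text \<open>The Hilbert series $\sum_j (\dim_K M_j) t^j$, given by its coefficients; equality of
  Hilbert series is equality of these functions.\<close>

definition hilbert_series ::
    "(('n::finite, 'k::field) mpoly, 'b) module \<Rightarrow> (int \<Rightarrow> 'b set) \<Rightarrow> int \<Rightarrow> nat"
  where "hilbert_series M D j =
    vectorspace.dim (class_ring :: 'k ring) (restrict_scalars M (D j))"


section \<open>Hilbert depth\<close>

text \<open>HOL cannot quantify over modules with carriers in arbitrary types. Here \<open>N\<close> ranges over all
  modules whose elements are taken from the type of sets of polynomials. This loses
  nothing: a finitely generated \<open>S\<close>-module is a quotient of some $S^m$, so it has at most as many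
  elements as the infinite set \<open>S\<close> and is isomorphic to a module on a subset of this type,
  and the grading and all notions used are invariant under isomorphism.

  If the Hilbert series of \<open>M\<close> is nonzero, the depths of the modules \<open>N\<close> are bounded by the number
  of variables. So if moreover \<open>M\<close> is finitely generated and graded, this is the maximum of a
  finite nonempty set.\<close>

definition hdepth ::
    "(('n::finite, 'k::field) mpoly, 'b) module \<Rightarrow> (int \<Rightarrow> 'b set) \<Rightarrow> nat"
  where "hdepth M D = Max {r.
    \<exists>(N :: (('n, 'k) mpoly, ('n, 'k) mpoly set) module) E.
      fin_gen_module poly_ring N \<and> graded_module N E \<and>
      hilbert_series N E = hilbert_series M D \<and> depth N = r}"


section \<open>The graded module \<open>J/I\<close>\<close>

text \<open>Addition and scalar multiplication are those of the quotient ring \<open>S Quot I\<close>; the carrier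
  consists of the cosets of the elements of \<open>J\<close>.\<close>

definition quot_module ::
    "('n::finite, 'k::field) mpoly set \<Rightarrow> ('n, 'k) mpoly set \<Rightarrow>
      (('n, 'k) mpoly, ('n, 'k) mpoly set) module"
  where "quot_module J I =
    \<lparr>carrier = (\<lambda>f. I +>\<^bsub>poly_ring\<^esub> f) ` J,
     mult = mult (poly_ring Quot I), one = one (poly_ring Quot I),
     zero = zero (poly_ring Quot I), add = add (poly_ring Quot I),
     smult = (\<lambda>f X. mult (poly_ring Quot I) (I +>\<^bsub>poly_ring\<^esub> f) X)\<rparr>"

definition quot_grading ::
    "('n::finite, 'k::field) mpoly set \<Rightarrow> ('n, 'k) mpoly set \<Rightarrow> int \<Rightarrow> ('n, 'k) mpoly set set"
  where "quot_grading J I j = (\<lambda>f. I +>\<^bsub>poly_ring\<^esub> f) ` (J \<inter> homogeneous_polys j)"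

end

theory Submission
  imports Defs "HOL-Library.Cardinality"
begin

text \<open>The module \<open>J/I\<close> itself competes in the maximum defining the Hilbert depth, so it suffices that
  this is a maximum over a bounded set. In fact a regular sequence $f_1, \dots, f_r$ on any
  \<open>S\<close>-module \<open>N\<close> has length at most \<open>n\<close>: choose $x \in N$ outside $(f_1, \dots, f_r)N$; by regularity a
  polynomial over \<open>K\<close> in the $f_i$ that annihilates \<open>x\<close> has only zero coefficients. But if $r > n$,
  the $f_i$ are algebraically dependent over \<open>K\<close>, because for large \<open>k\<close> there are more products
  $f^\alpha$ with $\alpha \in \{0, \dots, k\}^r$ than monomials that can occur in them.\<close>

section \<open>Algebraic dependence\<close>

lemma underdetermined_system_nontrivial:
  fixes a :: "'i \<Rightarrow> 'j \<Rightarrow> 'k::field"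
  assumes "finite E" "finite I" "card E < card I"
  shows "\<exists>c. (\<exists>i\<in>I. c i \<noteq> 0) \<and> (\<forall>j\<in>E. (\<Sum>i\<in>I. c i * a i j) = 0)"
  using assms
proof (induction E arbitrary: I a rule: finite_induct)
  case empty
  then have "I \<noteq> {}" by auto
  then show ?case by (intro exI[of _ "\<lambda>_. 1"]) auto
next
  case (insert e E)
  show ?case
  proof (cases "\<forall>i\<in>I. a i e = 0")
    case True
    then show ?thesis using insert.IH[of I a] insert by auto
  next
    case False
    then obtain p where p: "p \<in> I" "a p e \<noteq> 0" by auto
    \<comment> \<open>The coefficients left after equation \<open>e\<close> has been solved for the
      unknown at \<open>p\<close> and the result substituted into equation \<open>j\<close>.\<close>
    define a' where "a' i j = a i j - a i e / a p e * a p j" for i j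
    have "card E < card (I - {p})"
      using insert p by simp
    with insert.IH[of "I - {p}" a'] insert.prems obtain c where
      c: "\<exists>i\<in>I - {p}. c i \<noteq> 0" "\<And>j. j \<in> E \<Longrightarrow> (\<Sum>i\<in>I - {p}. c i * a' i j) = 0"
      by auto
    \<comment> \<open>The value \<open>- s\<close> is the one that equation \<open>e\<close> forces
      on the pivot unknown.\<close>
    define s where "s = (\<Sum>i\<in>I - {p}. c i * (a i e / a p e))"
    define c' where "c' = c(p := - s)"
    have sum: "(\<Sum>i\<in>I. c' i * a i j) = (\<Sum>i\<in>I - {p}. c i * a i j) - s * a p j" for j
    proof -
      have "(\<Sum>i\<in>I. c' i * a i j) = c' p * a p j + (\<Sum>i\<in>I - {p}. c' i * a i j)"
        using p insert.prems by (simp add: sum.remove)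
      also have "(\<Sum>i\<in>I - {p}. c' i * a i j) = (\<Sum>i\<in>I - {p}. c i * a i j)"
        by (intro sum.cong) (auto simp: c'_def)
      finally show ?thesis by (simp add: c'_def)
    qed
    have "(\<Sum>i\<in>I. c' i * a i j) = 0" if "j \<in> insert e E" for j
    proof (cases "j = e")
      case True
      then show ?thesis using p by (simp add: sum s_def sum_distrib_right)
    next
      case False
      with that have "(\<Sum>i\<in>I - {p}. c i * a' i j) = 0" using c by auto
      then show ?thesis
        unfolding sum s_def
        by (simp add: a'_def sum_distrib_left sum_subtractf algebra_simps)
    qed
    moreover have "\<exists>i\<in>I. c' i \<noteq> 0" using c(1) by (auto simp: c'_def)
    ultimately show ?thesis by blast
  qed
qed

section \<open>Exponent bounds for products of powers\<close>

text \<open>Each exponent is bounded separately, not the total degree, so that the admissible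
  monomials form a box of \<open>(d + 1) ^ CARD('n)\<close> elements.\<close>

definition exponents_le :: "nat \<Rightarrow> ('n::finite, 'k::field) mpoly \<Rightarrow> bool" where
  "exponents_le d f \<longleftrightarrow> (\<forall>m\<in>Poly_Mapping.keys f. \<forall>i. Poly_Mapping.lookup m i \<le> d)"

lemma exponents_le_mono: "exponents_le d f \<Longrightarrow> d \<le> d' \<Longrightarrow> exponents_le d' f"
  unfolding exponents_le_def by (meson le_trans)

lemma exponents_le_exists:
  fixes f :: "('n::finite, 'k::field) mpoly"
  shows "\<exists>d. exponents_le d f"
proof -
  let ?A = "(\<lambda>(m, i). Poly_Mapping.lookup m i) ` (Poly_Mapping.keys f \<times> UNIV)"
  have "finite ?A" by simp
  then show ?thesis
    unfolding exponents_le_def by (intro exI[of _ "Max ?A"]) (auto intro!: Max_ge)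
qed

lemma exponents_le_list_exists:
  fixes fs :: "('n::finite, 'k::field) mpoly list"
  shows "\<exists>d. \<forall>f\<in>set fs. exponents_le d f"
proof (induction fs)
  case (Cons f fs)
  then obtain d where "\<forall>g\<in>set fs. exponents_le d g" by blast
  moreover obtain d' where "exponents_le d' f" using exponents_le_exists by blast
  ultimately show ?case
    by (intro exI[of _ "max d d'"]) (auto intro: exponents_le_mono)
qed simp

lemma exponents_le_one: "exponents_le d 1"
  by (simp add: exponents_le_def)

lemma exponents_le_mult:
  assumes "exponents_le d f" "exponents_le e g"
  shows "exponents_le (d + e) (f * g)"
  unfolding exponents_le_def
proof (intro ballI allI)
  fix m i assume "m \<in> Poly_Mapping.keys (f * g)"
  then obtain a b where "m = a + b" "a \<in> Poly_Mapping.keys f" "b \<in> Poly_Mapping.keys g"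
    using keys_mult by fast
  then show "Poly_Mapping.lookup m i \<le> d + e"
    using assms by (auto simp: exponents_le_def lookup_add intro: add_mono)
qed

lemma exponents_le_power: "exponents_le d f \<Longrightarrow> exponents_le (j * d) (f ^ j)"
  by (induction j) (auto simp: exponents_le_one intro: exponents_le_mult)

lemma exponents_le_power_product:
  assumes "length \<alpha> = length fs" "\<forall>f\<in>set fs. exponents_le d f" "set \<alpha> \<subseteq> {..k}"
  shows "exponents_le (length fs * (k * d)) (prod_list (map2 (^) fs \<alpha>))"
  using assms
proof (induction \<alpha> fs rule: list_induct2)
  case (Cons j \<alpha> f fs)
  from Cons.prems have "exponents_le (j * d) (f ^ j)" by (simp add: exponents_le_power)
  then have "exponents_le (k * d) (f ^ j)"
    by (rule exponents_le_mono) (use Cons.prems in simp)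
  with Cons show ?case by (auto intro: exponents_le_mult)
qed (simp add: exponents_le_one)

lemma poly_mapping_eq_sum_single:
  "f = (\<Sum>m\<in>Poly_Mapping.keys f. Poly_Mapping.single m (Poly_Mapping.lookup f m))"
  by (rule poly_mapping_eqI)
    (auto simp: lookup_sum lookup_single when_def in_keys_iff sum.delta')

lemma lookup_Const_mult:
  fixes f :: "('n::finite, 'k::field) mpoly"
  shows "Poly_Mapping.lookup (Const c * f) m = c * Poly_Mapping.lookup f m"
proof -
  have "Const c * f = Const c * (\<Sum>m\<in>Poly_Mapping.keys f. Poly_Mapping.single m (Poly_Mapping.lookup f m))"
    using poly_mapping_eq_sum_single[of f] by simp
  also have "\<dots> = (\<Sum>m\<in>Poly_Mapping.keys f. Poly_Mapping.single m (c * Poly_Mapping.lookup f m))"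
    by (simp add: sum_distrib_left Const_def mult_single)
  finally show ?thesis
    by (auto simp: lookup_sum lookup_single when_def in_keys_iff sum.delta')
qed

lemma finite_bounded_exponents:
  "finite {m :: 'n::finite \<Rightarrow>\<^sub>0 nat. \<forall>i. Poly_Mapping.lookup m i \<le> b}" (is "finite ?M")
  and card_bounded_exponents:
  "card {m :: 'n::finite \<Rightarrow>\<^sub>0 nat. \<forall>i. Poly_Mapping.lookup m i \<le> b} \<le> (b + 1) ^ CARD('n)"
proof -
  have inj: "inj_on Poly_Mapping.lookup ?M"
    by (auto intro!: inj_onI poly_mapping_eqI)
  have sub: "Poly_Mapping.lookup ` ?M \<subseteq> (UNIV \<rightarrow>\<^sub>E {..b})"
    by auto
  have fin: "finite ((UNIV :: 'n set) \<rightarrow>\<^sub>E {..b})"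
    by (intro finite_PiE) auto
  show "finite ?M"
    using inj_on_finite[OF inj sub fin] .
  have "card ?M \<le> card ((UNIV :: 'n set) \<rightarrow>\<^sub>E {..b})"
    by (rule card_inj_on_le[OF inj sub fin])
  then show "card ?M \<le> (b + 1) ^ CARD('n)"
    by (simp add: card_funcsetE)
qed

text \<open>A full box again: its cardinality is exactly \<open>(k + 1) ^ r\<close>, and splitting
  off the first entry leaves a box of the same kind.\<close>

abbreviation exponent_lists :: "nat \<Rightarrow> nat \<Rightarrow> nat list set" where
  "exponent_lists k r \<equiv> {\<alpha>. set \<alpha> \<subseteq> {..k} \<and> length \<alpha> = r}"

lemma algebraically_dependent:
  fixes fs :: "('n::finite, 'k::field) mpoly list"
  assumes "CARD('n) < length fs"
  shows "\<exists>k c. (\<exists>\<alpha>\<in>exponent_lists k (length fs). c \<alpha> \<noteq> 0) \<and>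
    (\<Sum>\<alpha>\<in>exponent_lists k (length fs). Const (c \<alpha>) * prod_list (map2 (^) fs \<alpha>)) = 0"
proof -
  obtain d where d: "\<forall>f\<in>set fs. exponents_le d f"
    using exponents_le_list_exists by blast
  define r where "r = length fs"
  \<comment> \<open>Large enough for the count: \<open>b + 1 \<le> (r * d + 1) * (k + 1)\<close>,
    hence \<open>(b + 1) ^ n \<le> k * (k + 1) ^ n < (k + 1) ^ (n + 1)\<close> with
    \<open>n = CARD('n)\<close>, while \<open>X\<close> has \<open>(k + 1) ^ r\<close> elements and
    \<open>r > n\<close>.\<close>
  define k where "k = (r * d + 1) ^ CARD('n)"
  define b where "b = r * (k * d)"
  define M where "M = {m :: 'n \<Rightarrow>\<^sub>0 nat. \<forall>i. Poly_Mapping.lookup m i \<le> b}"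
  define X where "X = exponent_lists k r"
  have "finite M" unfolding M_def by (rule finite_bounded_exponents)
  have "finite X" unfolding X_def by (simp add: finite_lists_length_eq)
  have "card M \<le> (b + 1) ^ CARD('n)" unfolding M_def by (rule card_bounded_exponents)
  also have "\<dots> \<le> ((r * d + 1) * (k + 1)) ^ CARD('n)"
    by (intro power_mono) (auto simp: b_def algebra_simps)
  also have "\<dots> = k * (k + 1) ^ CARD('n)" by (simp only: power_mult_distrib k_def)
  also have "\<dots> < (k + 1) ^ (CARD('n) + 1)" by simp
  also have "\<dots> \<le> (k + 1) ^ r" using assms by (intro power_increasing) (auto simp: r_def)
  also have "\<dots> = card X" by (simp add: X_def card_lists_length_eq)
  finally have "card M < card X" .
  \<comment> \<open>The unknowns are the coefficients \<open>c \<alpha>\<close>; there is one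
    equation for every monomial in \<open>M\<close>, saying that it cancels in the sum.\<close>
  from underdetermined_system_nontrivial[OF \<open>finite M\<close> \<open>finite X\<close> this,
      of "\<lambda>\<alpha>. Poly_Mapping.lookup (prod_list (map2 (^) fs \<alpha>))"]
  obtain c where c: "\<exists>\<alpha>\<in>X. c \<alpha> \<noteq> 0"
    "\<And>m. m \<in> M \<Longrightarrow> (\<Sum>\<alpha>\<in>X. c \<alpha> * Poly_Mapping.lookup (prod_list (map2 (^) fs \<alpha>)) m) = 0"
    by blast
  have "(\<Sum>\<alpha>\<in>X. Const (c \<alpha>) * prod_list (map2 (^) fs \<alpha>)) = 0"
  proof (rule poly_mapping_eqI)
    fix m
    have "(\<Sum>\<alpha>\<in>X. c \<alpha> * Poly_Mapping.lookup (prod_list (map2 (^) fs \<alpha>)) m) = 0"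
    proof (cases "m \<in> M")
      \<comment> \<open>Monomials outside the box occur in none of the products.\<close>
      case False
      have "Poly_Mapping.lookup (prod_list (map2 (^) fs \<alpha>)) m = 0" if "\<alpha> \<in> X" for \<alpha>
      proof -
        have "exponents_le b (prod_list (map2 (^) fs \<alpha>))"
          unfolding b_def r_def
          by (rule exponents_le_power_product) (use that d in \<open>auto simp: X_def r_def\<close>)
        with False have "m \<notin> Poly_Mapping.keys (prod_list (map2 (^) fs \<alpha>))"
          by (auto simp: exponents_le_def M_def)
        then show ?thesis by (simp add: in_keys_iff)
      qed
      then show ?thesis by simp
    qed (rule c)
    then show "Poly_Mapping.lookup (\<Sum>\<alpha>\<in>X. Const (c \<alpha>) * prod_list (map2 (^) fs \<alpha>)) m
        = Poly_Mapping.lookup 0 m"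
      by (simp add: lookup_sum lookup_Const_mult)
  qed
  with c(1) show ?thesis unfolding X_def r_def by blast
qed

section \<open>Regular sequences\<close>

lemma ideal_mult_submodule:
  assumes "module poly_ring N"
  shows "submodule poly_ring (ideal_mult poly_ring N fs) N"
proof -
  interpret N: Module.module poly_ring N by fact
  show ?thesis
    unfolding ideal_mult_def by (rule N.span_is_submodule) auto
qed

lemma smult_in_ideal_mult:
  assumes "module poly_ring N" "f \<in> set fs" "x \<in> carrier N"
  shows "f \<odot>\<^bsub>N\<^esub> x \<in> ideal_mult poly_ring N fs"
proof -
  interpret N: Module.module poly_ring N by fact
  have "{f \<odot>\<^bsub>N\<^esub> x | f x. f \<in> set fs \<and> x \<in> carrier N} \<subseteq> carrier N" by auto
  from N.in_own_span[OF this] show ?thesis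
    using assms unfolding ideal_mult_def by blast
qed

lemma ideal_mult_mono:
  assumes "module poly_ring N" "set es \<subseteq> set fs"
  shows "ideal_mult poly_ring N es \<subseteq> ideal_mult poly_ring N fs"
proof -
  interpret N: Module.module poly_ring N by fact
  show ?thesis
    unfolding ideal_mult_def by (rule N.span_is_monotone) (use assms(2) in auto)
qed

text \<open>Splitting the list as \<open>es @ g # gs\<close> replaces the index in the definition of
  regularity by the position \<open>length es\<close>, which suits an induction that moves entries
  from \<open>gs\<close> to \<open>es\<close>.\<close>

lemma regular_sequence_nth_cancel:
  assumes "regular_sequence poly_ring N (es @ g # gs)" "y \<in> carrier N"
    and "g \<odot>\<^bsub>N\<^esub> y \<in> ideal_mult poly_ring N es"
  shows "y \<in> ideal_mult poly_ring N es"
proof -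
  have "\<forall>i<length (es @ g # gs). \<forall>y\<in>carrier N.
      ((es @ g # gs) ! i) \<odot>\<^bsub>N\<^esub> y \<in> ideal_mult poly_ring N (take i (es @ g # gs))
      \<longrightarrow> y \<in> ideal_mult poly_ring N (take i (es @ g # gs))"
    using assms(1) unfolding regular_sequence_def by blast
  from this[rule_format, of "length es" y] assms(2,3) show ?thesis by simp
qed

text \<open>Serves to read a polynomial in \<open>g # gs\<close> as a polynomial in \<open>g\<close>
  whose coefficients are polynomials in \<open>gs\<close>.\<close>

lemma sum_exponent_lists_Suc:
  fixes h :: "nat list \<Rightarrow> 'a::comm_monoid_add"
  shows "(\<Sum>\<alpha>\<in>exponent_lists k (Suc r). h \<alpha>) = (\<Sum>j<Suc k. \<Sum>\<beta>\<in>exponent_lists k r. h (j # \<beta>))"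
proof -
  have "exponent_lists k (Suc r) = (\<lambda>(j, \<beta>). j # \<beta>) ` ({..<Suc k} \<times> exponent_lists k r)"
    by (auto simp: length_Suc_conv image_iff less_Suc_eq_le)
  moreover have "inj_on (\<lambda>(j, \<beta>). j # \<beta>) ({..<Suc k} \<times> exponent_lists k r)"
    by (auto simp: inj_on_def)
  ultimately show ?thesis
    by (simp add: sum.reindex sum.cartesian_product split_def del: sum.lessThan_Suc)
qed

text \<open>Modulo \<open>g N\<close> only the constant term of a polynomial in \<open>g\<close> survives; once it vanishes,
  one factor \<open>g\<close> can be cancelled.\<close>

lemma power_sum_coefficients:
  assumes N: "module poly_ring N" and x: "x \<in> carrier N"
    and reg: "regular_sequence poly_ring N (es @ g # gs)"
    and zero: "\<And>j. P j \<odot>\<^bsub>N\<^esub> x \<in> ideal_mult poly_ring N (es @ [g]) \<Longrightarrow> P j = 0"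
    and "(\<Sum>j<n. g ^ j * P j) \<odot>\<^bsub>N\<^esub> x \<in> ideal_mult poly_ring N es"
    and "j < n"
  shows "P j = 0"
  using assms(4-)
proof (induction n arbitrary: P j)
  case (Suc n)
  interpret N: Module.module poly_ring N by fact
  interpret W': submodule poly_ring "ideal_mult poly_ring N (es @ [g])" N
    by (rule ideal_mult_submodule[OF N])
  have closed: "f \<odot>\<^bsub>N\<^esub> y \<in> carrier N" if "y \<in> carrier N" for f y
    using that by simp
  \<comment> \<open>The higher terms with one factor \<open>g\<close> removed: a sum of the same
    shape, with \<open>P\<close> shifted and one term fewer.\<close>
  define q where "q = (\<Sum>j<n. g ^ j * P (Suc j))"
  have split: "(\<Sum>j<Suc n. g ^ j * P j) = P 0 + g * q"
    by (simp add: sum.lessThan_Suc_shift q_def sum_distrib_left mult.assoc del: sum.lessThan_Suc)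
  define w where "w = (P 0 + g * q) \<odot>\<^bsub>N\<^esub> x"
  have w: "w \<in> ideal_mult poly_ring N es" using Suc.prems split by (simp add: w_def)
  \<comment> \<open>Solving for the constant term makes \<open>P 0\<close> times \<open>x\<close>
    the sum of \<open>w\<close> and a multiple of \<open>g\<close>. So it lies in the submodule of
    \<open>es @ [g]\<close>, and the assumption on \<open>P\<close> applies.\<close>
  have "P 0 = (P 0 + g * q) + g * (- q)" by simp
  then have "P 0 \<odot>\<^bsub>N\<^esub> x = w \<oplus>\<^bsub>N\<^esub> (g * (- q)) \<odot>\<^bsub>N\<^esub> x"
    using N.smult_l_distr[of "P 0 + g * q" "g * (- q)" x] x by (simp add: w_def)
  also have "(g * (- q)) \<odot>\<^bsub>N\<^esub> x = g \<odot>\<^bsub>N\<^esub> ((- q) \<odot>\<^bsub>N\<^esub> x)"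
    using N.smult_assoc1[of g "- q" x] x by simp
  finally have "P 0 \<odot>\<^bsub>N\<^esub> x = w \<oplus>\<^bsub>N\<^esub> g \<odot>\<^bsub>N\<^esub> ((- q) \<odot>\<^bsub>N\<^esub> x)" .
  moreover have "w \<in> ideal_mult poly_ring N (es @ [g])"
    using w ideal_mult_mono[OF N, of es "es @ [g]"] by auto
  moreover have "g \<odot>\<^bsub>N\<^esub> ((- q) \<odot>\<^bsub>N\<^esub> x) \<in> ideal_mult poly_ring N (es @ [g])"
    by (rule smult_in_ideal_mult[OF N]) (use x in auto)
  ultimately have P0: "P 0 = 0"
    using Suc.prems(1) by simp
  have "g \<odot>\<^bsub>N\<^esub> (q \<odot>\<^bsub>N\<^esub> x) = w"
    using N.smult_assoc1[of g q x] x by (simp add: w_def P0)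
  with w have "q \<odot>\<^bsub>N\<^esub> x \<in> ideal_mult poly_ring N es"
    using regular_sequence_nth_cancel[OF reg closed[OF x]] by simp
  then have "P (Suc i) = 0" if "i < n" for i
    unfolding q_def by (intro Suc.IH[where P = "\<lambda>j. P (Suc j)", OF _ _ that] Suc.prems(1))
  with P0 \<open>j < Suc n\<close> show ?case by (cases j) auto
qed simp

text \<open>Induction on \<open>gs\<close>, moving its head \<open>g\<close> into \<open>es\<close>;
  the whole list, and with it the assumption on \<open>x\<close>, stays the same. The relation is
  viewed as a polynomial in \<open>g\<close> with coefficients \<open>P j\<close>; the induction
  hypothesis for \<open>es @ [g]\<close> is what \<open>power_sum_coefficients\<close> requires to
  make every \<open>P j\<close> vanish.\<close>

lemma regular_sequence_independent:
  fixes N :: "(('n::finite, 'k::field) mpoly, 'b) module"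
  assumes N: "module poly_ring N" and x: "x \<in> carrier N"
    and "regular_sequence poly_ring N (es @ gs)" "x \<notin> ideal_mult poly_ring N (es @ gs)"
    and "(\<Sum>\<alpha>\<in>exponent_lists k (length gs). Const (c \<alpha>) * prod_list (map2 (^) gs \<alpha>)) \<odot>\<^bsub>N\<^esub> x
      \<in> ideal_mult poly_ring N es"
    and "\<alpha> \<in> exponent_lists k (length gs)"
  shows "c \<alpha> = 0"
  using assms(3-)
proof (induction gs arbitrary: es c \<alpha>)
  case Nil
  interpret N: Module.module poly_ring N by fact
  interpret W: submodule poly_ring "ideal_mult poly_ring N es" N
    by (rule ideal_mult_submodule[OF N])
  have "exponent_lists k 0 = {[]}" by auto
  with Nil.prems have in_W: "Const (c []) \<odot>\<^bsub>N\<^esub> x \<in> ideal_mult poly_ring N es"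
    by simp
  \<comment> \<open>A nonzero constant is a unit, so it could be cancelled and \<open>x\<close>
    would lie in the submodule of \<open>es\<close>, which is now the whole sequence.\<close>
  have "c [] = 0"
  proof (rule ccontr)
    assume "c [] \<noteq> 0"
    then have "Const (1 / c []) * Const (c []) = (1 :: ('n, 'k) mpoly)"
      by (simp add: Const_def mult_single)
    then have "x = Const (1 / c []) \<odot>\<^bsub>N\<^esub> (Const (c []) \<odot>\<^bsub>N\<^esub> x)"
      using N.smult_assoc1[of "Const (1 / c [])" "Const (c [])" x] N.smult_one[of x] x by simp
    also have "\<dots> \<in> ideal_mult poly_ring N es" using in_W by simp
    finally show False using Nil.prems by simp
  qed
  with Nil.prems show ?case by simp
next
  case (Cons g gs)
  define P where
    "P j = (\<Sum>\<beta>\<in>exponent_lists k (length gs). Const (c (j # \<beta>)) * prod_list (map2 (^) gs \<beta>))" for j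
  have IH: "c (j # \<beta>) = 0"
    if "P j \<odot>\<^bsub>N\<^esub> x \<in> ideal_mult poly_ring N (es @ [g])" "\<beta> \<in> exponent_lists k (length gs)" for j \<beta>
    using Cons.IH[of "es @ [g]" "\<lambda>\<beta>. c (j # \<beta>)" \<beta>] Cons.prems that by (simp add: P_def)
  have zero: "P j = 0" if "P j \<odot>\<^bsub>N\<^esub> x \<in> ideal_mult poly_ring N (es @ [g])" for j
    using IH[OF that] by (simp add: P_def Const_def)
  have "(\<Sum>j<Suc k. g ^ j * P j) =
      (\<Sum>\<alpha>\<in>exponent_lists k (length (g # gs)). Const (c \<alpha>) * prod_list (map2 (^) (g # gs) \<alpha>))"
    unfolding length_Cons sum_exponent_lists_Suc P_def
    by (simp add: sum_distrib_left mult_ac del: sum.lessThan_Suc)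
  with Cons.prems(3) have *: "(\<Sum>j<Suc k. g ^ j * P j) \<odot>\<^bsub>N\<^esub> x \<in> ideal_mult poly_ring N es" by simp
  from Cons.prems(4) obtain j \<beta> where \<alpha>: "\<alpha> = j # \<beta>" "j < Suc k"
      "\<beta> \<in> exponent_lists k (length gs)"
    by (auto simp: length_Suc_conv less_Suc_eq_le)
  have "P j = 0"
    by (rule power_sum_coefficients[OF N x Cons.prems(1) zero * \<alpha>(2)])
  interpret N: Module.module poly_ring N by fact
  interpret W': submodule poly_ring "ideal_mult poly_ring N (es @ [g])" N
    by (rule ideal_mult_submodule[OF N])
  \<comment> \<open>\<open>P j = 0\<close> as a polynomial does not yet give zero coefficients,
    since the products might satisfy a relation. But zero times \<open>x\<close> lies in the
    submodule, so the induction hypothesis applies a second time.\<close>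
  have "P j \<odot>\<^bsub>N\<^esub> x \<in> ideal_mult poly_ring N (es @ [g])"
    using N.lmult_0[OF x] W'.zero_closed \<open>P j = 0\<close> by simp
  from IH[OF this \<alpha>(3)] show ?case by (simp add: \<alpha>)
qed

proposition regular_sequence_length_le:
  fixes N :: "(('n::finite, 'k::field) mpoly, 'b) module"
  assumes N: "module poly_ring N" and reg: "regular_sequence poly_ring N fs"
  shows "length fs \<le> CARD('n)"
proof (rule ccontr)
  assume "\<not> length fs \<le> CARD('n)"
  then obtain k c where c: "\<exists>\<alpha>\<in>exponent_lists k (length fs). c \<alpha> \<noteq> 0"
    "(\<Sum>\<alpha>\<in>exponent_lists k (length fs). Const (c \<alpha>) * prod_list (map2 (^) fs \<alpha>)) = 0"
    using algebraically_dependent[of fs] by auto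
  interpret N: Module.module poly_ring N by fact
  interpret W: submodule poly_ring "ideal_mult poly_ring N []" N
    by (rule ideal_mult_submodule[OF N])
  have "ideal_mult poly_ring N fs \<subseteq> carrier N" "ideal_mult poly_ring N fs \<noteq> carrier N"
    using submodule.subset[OF ideal_mult_submodule[OF N]] reg
    by (auto simp: regular_sequence_def)
  then obtain x where x: "x \<in> carrier N" "x \<notin> ideal_mult poly_ring N fs" by blast
  \<comment> \<open>The relation is the zero polynomial and sends \<open>x\<close> to zero, which
    lies in every submodule. Independence is therefore applied with nothing moved to
    \<open>es\<close> yet.\<close>
  have "(\<Sum>\<alpha>\<in>exponent_lists k (length fs). Const (c \<alpha>) * prod_list (map2 (^) fs \<alpha>)) \<odot>\<^bsub>N\<^esub> x
      \<in> ideal_mult poly_ring N []"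
    using N.lmult_0[OF x(1)] W.zero_closed by (simp add: c(2))
  from regular_sequence_independent[OF N x(1), where es = "[]", OF _ _ this] reg x(2) c(1)
  show False by auto
qed

text \<open>The maximum over the empty set, an unspecified number, is the value of the depth of the
  zero module.\<close>

corollary depth_le:
  fixes N :: "(('n::finite, 'k::field) mpoly, 'b) module"
  assumes "module poly_ring N"
  shows "depth N \<le> max CARD('n) (Max {})"
proof -
  let ?L = "{length fs | fs. set fs \<subseteq> max_ideal \<and> regular_sequence poly_ring N fs}"
  have sub: "?L \<subseteq> {..CARD('n)}"
    using regular_sequence_length_le[OF assms] by auto
  then have "finite ?L" by (rule finite_subset) simp
  show ?thesis
  proof (cases "?L = {}")
    case True
    then show ?thesis unfolding depth_def depth_wrt_def by (simp only: True max.cobounded2)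
  next
    case False
    from Max_in[OF \<open>finite ?L\<close> this] sub have "Max ?L \<le> CARD('n)" by blast
    then show ?thesis unfolding depth_def depth_wrt_def by simp
  qed
qed

section \<open>Monomial ideals\<close>

text \<open>Closure under negation follows from multiplication by \<open>- 1\<close>.\<close>

lemma ideal_class_ring_iff:
  fixes I :: "'a::comm_ring_1 set"
  shows "ideal I class_ring \<longleftrightarrow>
    0 \<in> I \<and> (\<forall>a\<in>I. \<forall>b\<in>I. a + b \<in> I) \<and> (\<forall>a\<in>I. \<forall>r. r * a \<in> I)" (is "?L \<longleftrightarrow> ?R")
proof
  assume ?L
  then interpret ideal I class_ring .
  show ?R using zero_closed a_closed I_l_closed by auto
next
  assume R: ?R
  have neg: "- a \<in> I" if "a \<in> I" for a
  proof -
    have "(- 1) * a \<in> I" using R that by blast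
    then show ?thesis by simp
  qed
  show ?L
  proof (rule idealI)
    show "ring (class_ring :: 'a ring)" by (rule class_ring.ring_axioms)
    show "subgroup I (add_monoid class_ring)"
    proof
      fix a assume "a \<in> I"
      have "inv\<^bsub>add_monoid class_ring\<^esub> a = \<ominus>\<^bsub>class_ring\<^esub> a" by (simp only: a_inv_def)
      also have "\<dots> = - a" by (simp only: class_ring_simps)
      finally show "inv\<^bsub>add_monoid class_ring\<^esub> a \<in> I" using neg[OF \<open>a \<in> I\<close>] by simp
    qed (use R in auto)
  qed (use R in \<open>auto simp: mult.commute\<close>)
qed

lemma ideal_class_ring_closed:
  fixes I :: "'a::comm_ring_1 set"
  assumes "ideal I class_ring"
  shows "0 \<in> I" "a \<in> I \<Longrightarrow> b \<in> I \<Longrightarrow> a + b \<in> I" "a \<in> I \<Longrightarrow> r * a \<in> I"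
    "a \<in> I \<Longrightarrow> - a \<in> I"
proof -
  have I: "0 \<in> I" "\<forall>a\<in>I. \<forall>b\<in>I. a + b \<in> I" "\<forall>a\<in>I. \<forall>r. r * a \<in> I"
    using assms unfolding ideal_class_ring_iff by blast+
  show "0 \<in> I" "a \<in> I \<Longrightarrow> b \<in> I \<Longrightarrow> a + b \<in> I" "a \<in> I \<Longrightarrow> r * a \<in> I" using I by blast+
  show "- a \<in> I" if "a \<in> I"
    using I(3)[rule_format, OF that, of "- 1"] by simp
qed

lemma sum_in_ideal:
  fixes I :: "'a::comm_ring_1 set"
  assumes "ideal I class_ring" "\<And>a. a \<in> A \<Longrightarrow> f a \<in> I"
  shows "sum f A \<in> I"
  using assms(2)
  by (induction A rule: infinite_finite_induct) (use assms(1) in \<open>auto simp: ideal_class_ring_iff\<close>)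

section \<open>Monomial ideals described by supports\<close>

text \<open>\<open>m = g + u\<close> is divisibility of monomials, written on exponent vectors.
  Membership thus depends on the support only, so it passes to homogeneous components.\<close>

definition monomial_ideal :: "('n::finite \<Rightarrow>\<^sub>0 nat) set \<Rightarrow> ('n, 'k::field) mpoly set" where
  "monomial_ideal G = {f. \<forall>m\<in>Poly_Mapping.keys f. \<exists>g\<in>G. \<exists>u. m = g + u}"

lemma ideal_monomial_ideal: "ideal (monomial_ideal G) poly_ring"
proof -
  have "r * f \<in> monomial_ideal G" if f: "f \<in> monomial_ideal G" for r f
    unfolding monomial_ideal_def
  proof (intro CollectI ballI)
    fix m assume "m \<in> Poly_Mapping.keys (r * f)"
    then obtain a b where "m = a + b" "b \<in> Poly_Mapping.keys f"
      using keys_mult by fast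
    moreover from this f obtain g u where "g \<in> G" "b = g + u"
      unfolding monomial_ideal_def by blast
    ultimately have "g \<in> G" "m = g + (u + a)" by (simp_all add: ac_simps)
    then show "\<exists>g\<in>G. \<exists>u. m = g + u" by blast
  qed
  moreover have "f + h \<in> monomial_ideal G" if "f \<in> monomial_ideal G" "h \<in> monomial_ideal G" for f h
    using that keys_add[of f h] unfolding monomial_ideal_def by blast
  moreover have "0 \<in> monomial_ideal G" by (simp add: monomial_ideal_def)
  ultimately show ?thesis unfolding ideal_class_ring_iff by blast
qed

text \<open>A polynomial is the sum of its terms, and a term divisible by a generator is a multiple
  of it; conversely the support condition defines an ideal containing the generators.\<close>

lemma Idl_monomials_eq:
  "Idl\<^bsub>poly_ring\<^esub> ((\<lambda>g. Poly_Mapping.single g 1) ` G) = monomial_ideal G"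
  (is "?I = _")
proof
  have "(\<lambda>g. Poly_Mapping.single g 1) ` G \<subseteq> monomial_ideal G"
    by (auto simp: monomial_ideal_def) (metis add_0_right)
  then show "?I \<subseteq> monomial_ideal G"
    by (rule ring.genideal_minimal[OF class_ring.ring_axioms, OF ideal_monomial_ideal])
next
  have "ideal ?I poly_ring" by (rule ring.genideal_ideal[OF class_ring.ring_axioms]) simp
  then interpret I: ideal ?I poly_ring .
  have gens: "Poly_Mapping.single g 1 \<in> ?I" if "g \<in> G" for g
    by (rule subsetD[OF ring.genideal_self[OF class_ring.ring_axioms]]) (use that in auto)
  show "monomial_ideal G \<subseteq> ?I"
  proof
    fix f :: "('a, 'b) mpoly" assume f: "f \<in> monomial_ideal G"
    have "Poly_Mapping.single m (Poly_Mapping.lookup f m) \<in> ?I" if m: "m \<in> Poly_Mapping.keys f" for m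
    proof -
      from f m obtain g u where g: "g \<in> G" "m = g + u" by (auto simp: monomial_ideal_def)
      have "Poly_Mapping.single m (Poly_Mapping.lookup f m) =
          Poly_Mapping.single u (Poly_Mapping.lookup f m) * Poly_Mapping.single g 1"
        by (simp add: mult_single g(2) add.commute)
      then show ?thesis using I.I_l_closed[OF gens[OF g(1)]] by simp
    qed
    with sum_in_ideal[OF I.ideal_axioms]
    have "(\<Sum>m\<in>Poly_Mapping.keys f. Poly_Mapping.single m (Poly_Mapping.lookup f m)) \<in> ?I" .
    then show "f \<in> ?I"
      by (simp flip: poly_mapping_eq_sum_single)
  qed
qed

text \<open>A product of distinct variables is a single monomial, and there are only finitely many
  such products. Finiteness of \<open>G\<close> later gives finite generation of the
  quotient.\<close>

lemma squarefree_monomial_ideal_imp_monomial_ideal: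
  fixes I :: "('n::finite, 'k::field) mpoly set"
  assumes "squarefree_monomial_ideal I"
  shows "\<exists>G. finite G \<and> I = monomial_ideal G"
proof -
  from assms obtain F :: "'n set set"
    where I: "I = Idl\<^bsub>poly_ring\<^esub> ((\<lambda>A. \<Prod>i\<in>A. Var i) ` F)"
    by (auto simp: squarefree_monomial_ideal_def)
  define e where "e A = (\<Sum>i\<in>A. Poly_Mapping.single i (1 :: nat))" for A :: "'n set"
  have prod: "(\<Prod>i\<in>A. Var i) = (Poly_Mapping.single (e A) 1 :: ('n, 'k) mpoly)" for A
    by (induction A rule: infinite_finite_induct) (auto simp: e_def Var_def mult_single)
  have "I = Idl\<^bsub>poly_ring\<^esub> ((\<lambda>g. Poly_Mapping.single g 1) ` e ` F)"
    by (simp add: I prod image_image)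
  then have "I = monomial_ideal (e ` F)"
    by (simp only: Idl_monomials_eq)
  moreover have "finite (e ` F)" by simp
  ultimately show ?thesis by (intro exI conjI)
qed

section \<open>Homogeneous components\<close>

text \<open>An integer index matches the gradings; components of negative degree are zero.\<close>

definition hcomp :: "int \<Rightarrow> ('n::finite, 'k::field) mpoly \<Rightarrow> ('n, 'k) mpoly" where
  "hcomp j f = (\<Sum>m\<in>{m\<in>Poly_Mapping.keys f. int (mon_deg m) = j}.
    Poly_Mapping.single m (Poly_Mapping.lookup f m))"

lemma lookup_hcomp:
  "Poly_Mapping.lookup (hcomp j f) m = (Poly_Mapping.lookup f m when int (mon_deg m) = j)"
  by (auto simp: hcomp_def lookup_sum lookup_single when_def in_keys_iff sum.delta')

lemma hcomp_homogeneous: "hcomp j f \<in> homogeneous_polys j"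
  by (auto simp: homogeneous_polys_def in_keys_iff lookup_hcomp)

lemma keys_hcomp: "Poly_Mapping.keys (hcomp j f) \<subseteq> Poly_Mapping.keys f"
  by (auto simp: in_keys_iff lookup_hcomp)

text \<open>This is the homogeneity of monomial ideals: passing to a component only removes
  monomials from the support.\<close>

lemma hcomp_monomial_ideal: "f \<in> monomial_ideal G \<Longrightarrow> hcomp j f \<in> monomial_ideal G"
  using keys_hcomp[of j f] unfolding monomial_ideal_def by blast

lemma lookup_homogeneous:
  "f \<in> homogeneous_polys i \<Longrightarrow> int (mon_deg m) \<noteq> i \<Longrightarrow> Poly_Mapping.lookup f m = 0"
  by (auto simp: homogeneous_polys_def in_keys_iff)

lemma hcomp_of_homogeneous:
  "f \<in> homogeneous_polys i \<Longrightarrow> hcomp j f = (f when i = j)"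
  by (rule poly_mapping_eqI) (auto simp: lookup_hcomp when_def lookup_homogeneous)

lemma hcomp_diff: "hcomp j (f - g) = hcomp j f - hcomp j g"
  by (rule poly_mapping_eqI) (auto simp: lookup_hcomp lookup_minus when_def)

lemma hcomp_sum: "hcomp j (\<Sum>i\<in>A. f i) = (\<Sum>i\<in>A. hcomp j (f i))"
  by (rule poly_mapping_eqI) (auto simp: lookup_hcomp lookup_sum when_def)

lemma sum_hcomp:
  "(\<Sum>j\<in>(\<lambda>m. int (mon_deg m)) ` Poly_Mapping.keys f. hcomp j f) = f"
proof (rule poly_mapping_eqI)
  fix m
  show "Poly_Mapping.lookup (\<Sum>j\<in>(\<lambda>m. int (mon_deg m)) ` Poly_Mapping.keys f. hcomp j f) m
      = Poly_Mapping.lookup f m"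
    by (cases "m \<in> Poly_Mapping.keys f") (auto simp: lookup_sum lookup_hcomp when_def in_keys_iff)
qed

lemma hcomp_eq_0: "j \<notin> (\<lambda>m. int (mon_deg m)) ` Poly_Mapping.keys f \<Longrightarrow> hcomp j f = 0"
  by (rule poly_mapping_eqI) (auto simp: lookup_hcomp when_def in_keys_iff image_iff)

lemma homogeneous_polys_mult:
  assumes "f \<in> homogeneous_polys i" "g \<in> homogeneous_polys j"
  shows "f * g \<in> homogeneous_polys (i + j)"
  unfolding homogeneous_polys_def
proof (intro CollectI ballI)
  fix m assume "m \<in> Poly_Mapping.keys (f * g)"
  then obtain a b where "m = a + b" "a \<in> Poly_Mapping.keys f" "b \<in> Poly_Mapping.keys g"
    using keys_mult by fast
  with assms show "int (mon_deg m) = i + j"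
    by (auto simp: homogeneous_polys_def mon_deg_def lookup_add sum.distrib)
qed

lemma homogeneous_polys_add:
  "f \<in> homogeneous_polys j \<Longrightarrow> g \<in> homogeneous_polys j \<Longrightarrow> f + g \<in> homogeneous_polys j"
  using keys_add[of f g] unfolding homogeneous_polys_def by blast

lemma homogeneous_polys_uminus:
  "f \<in> homogeneous_polys j \<Longrightarrow> - f \<in> homogeneous_polys j"
  by (simp add: homogeneous_polys_def)

lemma homogeneous_polys_0: "0 \<in> homogeneous_polys j"
  by (simp add: homogeneous_polys_def)

section \<open>The quotient module\<close>

locale ideal_pair =
  fixes I J :: "('n::finite, 'k::field) mpoly set"
  assumes ideal_I: "ideal I poly_ring" and ideal_J: "ideal J poly_ring" and subset: "I \<subseteq> J"
begin

abbreviation cls :: "('n, 'k) mpoly \<Rightarrow> ('n, 'k) mpoly set" where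
  "cls f \<equiv> I +>\<^bsub>poly_ring\<^esub> f"

abbreviation QM :: "(('n, 'k) mpoly, ('n, 'k) mpoly set) module" where
  "QM \<equiv> quot_module J I"

lemmas I_closed = ideal_class_ring_closed[OF ideal_I]
  and J_closed = ideal_class_ring_closed[OF ideal_J]

lemma mem_cls_iff: "h \<in> cls f \<longleftrightarrow> h - f \<in> I"
  unfolding a_r_coset_def' by (auto intro!: bexI[of _ "h - f"])

lemma cls_eq_iff: "cls f = cls g \<longleftrightarrow> f - g \<in> I"
proof
  assume "cls f = cls g"
  then show "f - g \<in> I" using I_closed(1) mem_cls_iff[of f f] mem_cls_iff[of f g] by simp
next
  assume fg: "f - g \<in> I"
  have "h - f \<in> I \<longleftrightarrow> h - g \<in> I" for h
  proof
    show "h - g \<in> I" if "h - f \<in> I"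
      using I_closed(2)[OF that fg] by simp
    show "h - f \<in> I" if "h - g \<in> I"
      using I_closed(2)[OF that I_closed(4)[OF fg]] by simp
  qed
  then show "cls f = cls g" using mem_cls_iff by blast
qed

lemma cls_0: "cls 0 = I"
  using mem_cls_iff[of _ 0] by auto

lemma carrier_QM: "carrier QM = cls ` J"
  by (simp add: quot_module_def)

lemma zero_QM: "\<zero>\<^bsub>QM\<^esub> = cls 0"
  by (simp add: quot_module_def FactRing_def cls_0)

lemma add_QM: "cls f \<oplus>\<^bsub>QM\<^esub> cls g = cls (f + g)"
proof -
  interpret ideal I poly_ring by (rule ideal_I)
  show ?thesis
    using a_rcos_sum[of f g] by (simp add: quot_module_def FactRing_def)
qed

lemma smult_QM: "p \<odot>\<^bsub>QM\<^esub> cls f = cls (p * f)"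
proof -
  interpret ideal I poly_ring by (rule ideal_I)
  show ?thesis
    using rcoset_mult_add[of p f] by (simp add: quot_module_def FactRing_def)
qed

lemmas QM_simps = carrier_QM zero_QM add_QM smult_QM

lemma module_QM: "module poly_ring QM"
proof (rule moduleI)
  show "cring (poly_ring :: ('n, 'k) mpoly ring)" by (rule class_cring.cring_axioms)
  show "abelian_group QM"
  proof (rule abelian_groupI)
    fix x assume "x \<in> carrier QM"
    then obtain f where f: "x = cls f" "f \<in> J" by (auto simp: carrier_QM)
    then show "\<exists>y\<in>carrier QM. y \<oplus>\<^bsub>QM\<^esub> x = \<zero>\<^bsub>QM\<^esub>"
      by (intro bexI[of _ "cls (- f)"]) (auto simp: QM_simps J_closed)
  qed (auto simp: QM_simps J_closed ac_simps)
qed (auto simp: QM_simps J_closed algebra_simps)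

sublocale QM: Module.module poly_ring QM
  by (rule module_QM)

lemma uminus_QM:
  assumes "f \<in> J"
  shows "\<ominus>\<^bsub>QM\<^esub> cls f = cls (- f)"
  by (rule QM.minus_equality) (use assms in \<open>auto simp: QM_simps J_closed\<close>)

lemma finsum_QM:
  assumes "finite A" "\<And>a. a \<in> A \<Longrightarrow> f a \<in> J"
  shows "(\<Oplus>\<^bsub>QM\<^esub>a\<in>A. cls (f a)) = cls (\<Sum>a\<in>A. f a)"
  using assms
proof (induction A rule: finite_induct)
  case (insert a A)
  then have "(\<lambda>a. cls (f a)) \<in> A \<rightarrow> carrier QM" "cls (f a) \<in> carrier QM"
    by (auto simp: carrier_QM)
  with insert show ?case by (simp add: add_QM)
qed (simp add: zero_QM)

end

section \<open>Finite generation and grading of a quotient of monomial ideals\<close>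

locale monomial_ideal_pair = ideal_pair +
  fixes GI GJ
  assumes I_eq: "I = monomial_ideal GI" and J_eq: "J = monomial_ideal GJ"
    and finite_GJ: "finite GJ"
begin

lemma fin_gen_QM: "fin_gen_module poly_ring QM"
proof -
  define A where "A = (\<lambda>g. cls (Poly_Mapping.single g 1)) ` GJ"
  have J: "J = Idl\<^bsub>poly_ring\<^esub> ((\<lambda>g. Poly_Mapping.single g 1) ` GJ)"
    by (simp only: J_eq Idl_monomials_eq)
  have gens: "(\<lambda>g. Poly_Mapping.single g 1) ` GJ \<subseteq> J"
    unfolding J by (rule ring.genideal_self[OF class_ring.ring_axioms]) simp
  then have A: "A \<subseteq> carrier QM"
    by (auto simp: A_def carrier_QM)
  interpret S: submodule poly_ring "QM.span A" QM
    by (rule QM.span_is_submodule[OF A])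
  \<comment> \<open>The span is pulled back to polynomials: \<open>?K\<close> is an ideal containing
    the generators of \<open>J\<close>, so it contains \<open>J\<close> by minimality.\<close>
  let ?K = "{f \<in> J. cls f \<in> QM.span A}"
  have "ideal ?K poly_ring"
    unfolding ideal_class_ring_iff
  proof (intro conjI ballI allI)
    show "0 \<in> ?K" using S.zero_closed by (simp add: J_closed zero_QM)
    show "f + g \<in> ?K" if "f \<in> ?K" "g \<in> ?K" for f g
      using that S.m_closed[of "cls f" "cls g"] by (simp add: J_closed add_QM)
    show "p * f \<in> ?K" if "f \<in> ?K" for p f
      using that S.smult_closed[of p "cls f"] by (simp add: J_closed smult_QM)
  qed
  moreover have "(\<lambda>g. Poly_Mapping.single g 1) ` GJ \<subseteq> ?K"
    using gens QM.in_own_span[OF A] by (auto simp: A_def)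
  ultimately have "J \<subseteq> ?K"
    unfolding J by (intro ring.genideal_minimal[OF class_ring.ring_axioms])
  then have "QM.span A = carrier QM"
    using S.subset by (auto simp: carrier_QM)
  moreover have "finite A" using finite_GJ by (simp add: A_def)
  ultimately show ?thesis
    unfolding fin_gen_module_def using module_QM A by blast
qed

text \<open>Uniqueness of the decomposition: homogeneous lifts of the \<open>c j\<close> add up to
  \<open>g\<close> modulo \<open>I\<close>, and since \<open>I\<close> is homogeneous this
  congruence holds in every degree.\<close>

lemma decomposition_QM_eq:
  assumes c: "\<And>j. c j \<in> quot_grading J I j" and fin: "finite {j. c j \<noteq> \<zero>\<^bsub>QM\<^esub>}"
    and sum: "cls g = (\<Oplus>\<^bsub>QM\<^esub>j\<in>{j. c j \<noteq> \<zero>\<^bsub>QM\<^esub>}. c j)"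
  shows "c j = cls (hcomp j g)"
proof -
  let ?S = "{j. c j \<noteq> \<zero>\<^bsub>QM\<^esub>}"
  have "\<exists>f. f \<in> J \<and> f \<in> homogeneous_polys j \<and> c j = cls f" for j
    using c[of j] by (auto simp: quot_grading_def)
  then obtain f where f: "\<And>j. f j \<in> J" "\<And>j. f j \<in> homogeneous_polys j" "\<And>j. c j = cls (f j)"
    by metis
  have "cls g = (\<Oplus>\<^bsub>QM\<^esub>j\<in>?S. cls (f j))"
    using sum by (simp only: f(3))
  also have "\<dots> = cls (\<Sum>j\<in>?S. f j)"
    by (rule finsum_QM[OF fin f(1)])
  finally have "(\<Sum>i\<in>?S. f i) - g \<in> I" by (metis cls_eq_iff)
  then have "hcomp j ((\<Sum>i\<in>?S. f i) - g) \<in> I" unfolding I_eq by (rule hcomp_monomial_ideal)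
  \<comment> \<open>Only the lifts indexed by \<open>?S\<close> enter the sum. Elsewhere
    \<open>f j\<close> may be a nonzero element of \<open>I\<close>, so the component there is
    \<open>0\<close> and not \<open>f j\<close>.\<close>
  moreover have "hcomp j (\<Sum>i\<in>?S. f i) = (if j \<in> ?S then f j else 0)"
    using fin by (simp add: hcomp_sum hcomp_of_homogeneous[OF f(2)] when_def)
  ultimately have "(if j \<in> ?S then f j else 0) - hcomp j g \<in> I"
    by (simp add: hcomp_diff)
  then have eq: "cls (if j \<in> ?S then f j else 0) = cls (hcomp j g)"
    by (simp only: cls_eq_iff)
  have "c j = cls (if j \<in> ?S then f j else 0)"
    using f(3) by (auto simp: zero_QM)
  also note eq
  finally show ?thesis .
qed

text \<open>The components of \<open>g\<close> lie in \<open>J\<close> because \<open>J\<close> is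
  homogeneous; their classes are the summands.\<close>

lemma decomposition_QM_exists:
  assumes g: "g \<in> J"
  defines "c \<equiv> \<lambda>j. cls (hcomp j g)"
  shows "c j \<in> quot_grading J I j" "finite {j. c j \<noteq> \<zero>\<^bsub>QM\<^esub>}"
    "cls g = (\<Oplus>\<^bsub>QM\<^esub>j\<in>{j. c j \<noteq> \<zero>\<^bsub>QM\<^esub>}. c j)"
proof -
  let ?T = "(\<lambda>m. int (mon_deg m)) ` Poly_Mapping.keys g"
  let ?S = "{j. c j \<noteq> \<zero>\<^bsub>QM\<^esub>}"
  have J: "hcomp i g \<in> J" for i
    using g unfolding J_eq by (rule hcomp_monomial_ideal)
  then show "c j \<in> quot_grading J I j"
    by (auto simp: c_def quot_grading_def hcomp_homogeneous)
  have "?S \<subseteq> ?T"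
    using hcomp_eq_0[of _ g] by (force simp: c_def zero_QM)
  then show fin: "finite ?S" by (rule finite_subset) simp
  \<comment> \<open>A component with zero class lies in \<open>I\<close>, so restricting the sum
    from the degrees \<open>?T\<close> of \<open>g\<close> to \<open>?S\<close> changes it only by
    an element of \<open>I\<close>.\<close>
  have "hcomp i g \<in> I" if "i \<notin> ?S" for i
    using that cls_eq_iff[of "hcomp i g" 0] by (simp add: c_def zero_QM)
  then have "(\<Sum>i\<in>?T - ?S. hcomp i g) \<in> I"
    by (intro sum_in_ideal[OF ideal_I]) auto
  moreover have "g = (\<Sum>i\<in>?T - ?S. hcomp i g) + (\<Sum>i\<in>?S. hcomp i g)"
    using sum.subset_diff[OF \<open>?S \<subseteq> ?T\<close>, of "\<lambda>i. hcomp i g"] sum_hcomp[of g] by simp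
  ultimately have "g - (\<Sum>i\<in>?S. hcomp i g) \<in> I"
    by (metis add_diff_cancel_right')
  then have "cls g = cls (\<Sum>i\<in>?S. hcomp i g)"
    by (simp only: cls_eq_iff)
  also have "\<dots> = (\<Oplus>\<^bsub>QM\<^esub>i\<in>?S. c i)"
    unfolding c_def by (rule finsum_QM[symmetric]) (use fin J in \<open>auto simp: c_def\<close>)
  finally show "cls g = (\<Oplus>\<^bsub>QM\<^esub>i\<in>?S. c i)" .
qed

lemma additive_subgroup_quot_grading: "additive_subgroup (quot_grading J I j) QM"
proof
  let ?D = "quot_grading J I j"
  show "?D \<subseteq> carrier (add_monoid QM)"
    by (auto simp: quot_grading_def carrier_QM)
  show "x \<otimes>\<^bsub>add_monoid QM\<^esub> y \<in> ?D" if xy: "x \<in> ?D" "y \<in> ?D" for x y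
  proof -
    obtain f g where "x = cls f" "y = cls g" "f \<in> J \<inter> homogeneous_polys j"
        "g \<in> J \<inter> homogeneous_polys j"
      using xy by (auto simp: quot_grading_def)
    then show ?thesis
      by (auto simp: quot_grading_def add_QM J_closed homogeneous_polys_add intro!: imageI)
  qed
  show "\<one>\<^bsub>add_monoid QM\<^esub> \<in> ?D"
    by (auto simp: quot_grading_def zero_QM J_closed homogeneous_polys_0)
  show "inv\<^bsub>add_monoid QM\<^esub> x \<in> ?D" if x: "x \<in> ?D" for x
  proof -
    obtain f where f: "x = cls f" "f \<in> J" "f \<in> homogeneous_polys j"
      using x by (auto simp: quot_grading_def)
    have "inv\<^bsub>add_monoid QM\<^esub> x = cls (- f)"
      unfolding f(1) using uminus_QM[OF f(2)] by (simp only: a_inv_def)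
    then show ?thesis
      using f by (auto simp: quot_grading_def J_closed homogeneous_polys_uminus)
  qed
qed

lemma graded_QM: "graded_module QM (quot_grading J I)"
  unfolding graded_module_def
proof (intro conjI allI ballI)
  show "module poly_ring QM" by (rule module_QM)
  show "additive_subgroup (quot_grading J I j) QM" for j
    by (rule additive_subgroup_quot_grading)
  show "p \<odot>\<^bsub>QM\<^esub> x \<in> quot_grading J I (i + j)"
    if "p \<in> homogeneous_polys i" "x \<in> quot_grading J I j" for i j p x
    using that by (auto simp: quot_grading_def smult_QM J_closed homogeneous_polys_mult)
  fix x assume "x \<in> carrier QM"
  then obtain g where g: "x = cls g" "g \<in> J" by (auto simp: carrier_QM)
  show "\<exists>!c. (\<forall>j. c j \<in> quot_grading J I j) \<and> finite {j. c j \<noteq> \<zero>\<^bsub>QM\<^esub>} \<and>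
      x = (\<Oplus>\<^bsub>QM\<^esub>j\<in>{j. c j \<noteq> \<zero>\<^bsub>QM\<^esub>}. c j)"
    unfolding g(1)
  proof (rule ex1I[of _ "\<lambda>j. cls (hcomp j g)"])
    show "(\<forall>j. cls (hcomp j g) \<in> quot_grading J I j) \<and> finite {j. cls (hcomp j g) \<noteq> \<zero>\<^bsub>QM\<^esub>} \<and>
        cls g = (\<Oplus>\<^bsub>QM\<^esub>j\<in>{j. cls (hcomp j g) \<noteq> \<zero>\<^bsub>QM\<^esub>}. cls (hcomp j g))"
      using decomposition_QM_exists[OF g(2)] by blast
    show "c = (\<lambda>j. cls (hcomp j g))"
      if "(\<forall>j. c j \<in> quot_grading J I j) \<and> finite {j. c j \<noteq> \<zero>\<^bsub>QM\<^esub>} \<and>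
        cls g = (\<Oplus>\<^bsub>QM\<^esub>j\<in>{j. c j \<noteq> \<zero>\<^bsub>QM\<^esub>}. c j)" for c
      using that decomposition_QM_eq[of c g] by blast
  qed
qed

end

section \<open>Depth and Hilbert depth of the quotient\<close>

theorem theorem3p4:
  fixes I J :: "('n::finite, 'k::field) mpoly set"
  assumes "infinite (UNIV :: 'k set)"
    and "squarefree_monomial_ideal I"
    and "squarefree_monomial_ideal J"
    and "I \<subset> J"
  shows "hdepth (quot_module J I) (quot_grading J I) \<ge> depth (quot_module J I)"
proof -
  obtain GI where GI: "I = monomial_ideal GI"
    using squarefree_monomial_ideal_imp_monomial_ideal[OF assms(2)] by blast
  obtain GJ where GJ: "J = monomial_ideal GJ" "finite GJ"
    using squarefree_monomial_ideal_imp_monomial_ideal[OF assms(3)] by blast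
  interpret monomial_ideal_pair I J GI GJ
  proof (intro monomial_ideal_pair.intro ideal_pair.intro monomial_ideal_pair_axioms.intro)
    show "ideal I poly_ring" unfolding GI by (rule ideal_monomial_ideal)
    show "ideal J poly_ring" unfolding GJ by (rule ideal_monomial_ideal)
  qed (fact GI GJ psubset_imp_subset[OF assms(4)])+
  let ?R = "{r. \<exists>(N :: (('n, 'k) mpoly, ('n, 'k) mpoly set) module) E.
      fin_gen_module poly_ring N \<and> graded_module N E \<and>
      hilbert_series N E = hilbert_series QM (quot_grading J I) \<and> depth N = r}"
  \<comment> \<open>\<open>depth_le\<close> bounds the depth of every competing \<open>N\<close> at
    once, a zero module included, which is why \<open>Max {}\<close> enters the bound.\<close>
  have "?R \<subseteq> {..max CARD('n) (Max {})}"
    using depth_le by (auto simp: fin_gen_module_def simp del: max.bounded_iff)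
  then have "finite ?R" by (rule finite_subset) simp
  \<comment> \<open>The witness is \<open>QM\<close> with its own grading, so the Hilbert series
    agree trivially; its elements are sets of polynomials, as the definition of
    \<open>hdepth\<close> demands.\<close>
  moreover have "depth QM \<in> ?R"
    using fin_gen_QM graded_QM by blast
  ultimately show ?thesis
    unfolding hdepth_def by (rule Max_ge)
qed

end
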